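(* Let $M$ be a shifted matroid, let $\tilde M$ be the matroid obtained from $M$ by contracting all coloops of $M$, and let $T\subseteq[n']$ (where $n'$ is the size of the ground set of $\tilde M$) be such that $\tilde M$ is (isomorphic to) $\langle T\rangle$ on $[n']$. Then: (i) If $T$ has four or more blocks, $M$ is not threshold. (ii) If $T$ has two or fewer blocks, $M$ is threshold. (iii) If $T$ has exactly three blocks: (a) if the second block of $T$ or the second gap of $T$ has size one, then $M$ is threshold; (b) otherwise, $M$ is not threshold.
   Context: Matroids are given by their bases. For $S=\{s_1<\dots<s_k\}$ and $T=\{t_1<\dots<t_k\}$ in $\binom{[n]}{k}$, the component-wise partial order declares $S\prec T$ if $s_i\le t_i$ for all $i$. For $T\in\binom{[n]}{k}$, $\langle T\rangle$ denotes the matroid on $[n]$ whose set of bases is $\{S\in\binom{[n]}{k}: S\prec T\}$. A matroid is shifted if it is isomorphic to $\langle T\rangle$ for some $T$. A rank $k$ matroid $M$ on ground set $E$ is threshold if there is $w:E\to\mathbb{R}$ such that for every $k$-element $B\subseteq E$, $B$ is a basis of $M$ iff $\sum_{b\in B}w(b)>0$. Blocks and gaps: a nonempty $T\subseteq[n]$, written as an increasing word, decomposes uniquely as a concatenation $T=T_1T_2\cdots T_\ell$ of inclusion-maximal runs of consecutive integers; $T_i$ is the $i$-th block of $T$. The $j$-th block of $[n]\setminus T$ is called the $j$-th gap of $T$. (E.g. $23479\subseteq[10]$ has blocks $234,7,9$ and gaps $1,56,8,10$.) Note that when $M$ has no coloops, $1\notin T$, so the first gap precedes the first block and the second gap lies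 between the first and second blocks. *)

theory Defs
  imports Complex_Main
begin

section \<open>Finite matroids given by their bases\<close>

record 'a matroid =
  ground :: "'a set"
  bases :: "'a set set"

definition is_matroid :: "'a matroid \<Rightarrow> bool" where
  "is_matroid M \<longleftrightarrow>
     finite (ground M) \<and> bases M \<subseteq> Pow (ground M) \<and> bases M \<noteq> {} \<and>
     (\<forall>A\<in>bases M. \<forall>B\<in>bases M. \<forall>a\<in>A - B. \<exists>b\<in>B - A. insert b (A - {a}) \<in> bases M)"

text \<open>All bases of a matroid have the same size, so the image below is a singleton.\<close>

definition rank :: "'a matroid \<Rightarrow> nat" where
  "rank M = the_elem (card ` bases M)"

definition isomorphic :: "'a matroid \<Rightarrow> 'b matroid \<Rightarrow> bool" where
  "isomorphic M N \<longleftrightarrow>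
     (\<exists>f. bij_betw f (ground M) (ground N) \<and> bases N = (\<lambda>B. f ` B) ` bases M)"

definition coloops :: "'a matroid \<Rightarrow> 'a set" where
  "coloops M = {e \<in> ground M. \<forall>B\<in>bases M. e \<in> B}"

text \<open>The bases of \<open>M / X\<close> are the sets \<open>B - X\<close> where \<open>B\<close> is a basis of \<open>M\<close> for which
  \<open>B \<inter> X\<close> is a basis of the restriction of \<open>M\<close> to \<open>X\<close>, that is, for which \<open>B \<inter> X\<close> is as
  large as possible.\<close>

definition contract :: "'a matroid \<Rightarrow> 'a set \<Rightarrow> 'a matroid" where
  "contract M X =
     \<lparr>ground = ground M - X,
      bases = {B - X |B. B \<in> bases M \<and> (\<forall>B'\<in>bases M. card (B' \<inter> X) \<le> card (B \<inter> X))}\<rparr>"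

text \<open>A matroid of rank 0 is never threshold, because the empty sum is not positive.\<close>

definition threshold :: "'a matroid \<Rightarrow> bool" where
  "threshold M \<longleftrightarrow>
     (\<exists>w :: 'a \<Rightarrow> real. \<forall>B. B \<subseteq> ground M \<and> card B = rank M \<longrightarrow>
        (B \<in> bases M \<longleftrightarrow> (\<Sum>b\<in>B. w b) > 0))"

section \<open>Shifted matroids\<close>

text \<open>The component-wise order on finite sets of numbers; \<^const>\<open>list_all2\<close> also forces the
  two sets to have the same size.\<close>

definition componentwise_le :: "nat set \<Rightarrow> nat set \<Rightarrow> bool" (infix \<open>\<preceq>\<close> 50) where
  "S \<preceq> T \<longleftrightarrow> list_all2 (\<le>) (sorted_list_of_set S) (sorted_list_of_set T)"

definition shifted_matroid :: "nat \<Rightarrow> nat set \<Rightarrow> nat matroid" where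
  "shifted_matroid n T = \<lparr>ground = {1..n}, bases = {S. S \<subseteq> {1..n} \<and> card S = card T \<and> S \<preceq> T}\<rparr>"

definition shifted :: "'a matroid \<Rightarrow> bool" where
  "shifted M \<longleftrightarrow> (\<exists>n T. T \<subseteq> {1..n} \<and> isomorphic M (shifted_matroid n T))"

section \<open>Blocks and gaps\<close>

definition is_run :: "nat set \<Rightarrow> nat set \<Rightarrow> bool" where
  "is_run T R \<longleftrightarrow> R \<noteq> {} \<and> R \<subseteq> T \<and> (\<exists>a b. R = {a..b})"

text \<open>The blocks of a finite set, from left to right: its inclusion-maximal runs, which are
  pairwise disjoint and hence ordered by their minima. List indices start at 0, so the
  second block is \<open>blocks T ! 1\<close>. The empty set has no blocks.\<close>

definition blocks :: "nat set \<Rightarrow> nat set list" where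
  "blocks T = sorted_key_list_of_set Min
     {R. is_run T R \<and> (\<forall>R'. is_run T R' \<and> R \<subseteq> R' \<longrightarrow> R' = R)}"

definition gaps :: "nat \<Rightarrow> nat set \<Rightarrow> nat set list" where
  "gaps n T = blocks ({1..n} - T)"

end

theory Submission
  imports Defs
begin

text \<open>Coloops can be given a huge common weight, so \<open>M\<close> is threshold iff the bases of the
  contraction \<open>\<langle>T\<rangle>\<close> are cut out among the sets of size \<open>card T\<close> by an inequality
  \<open>w(B) > \<theta>\<close>. A set \<open>S\<close> of that size is a basis of \<open>\<langle>T\<rangle>\<close> iff it has at least as many elements up
  to \<open>m\<close> as \<open>T\<close> has, where it suffices to let \<open>m\<close> range over the right ends of the blocks of
  \<open>T\<close>; the last of these conditions only says that \<open>S\<close> avoids the loops. In the threshold cases,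
  the remaining at most two conditions are equivalent to a single weighted inequality. In the
  other cases, there are two bases and two nonbases with the same multiset union.\<close>

section \<open>Blocks of a finite set\<close>

text \<open>A pair holds the two ends of an interval. The \<open>Suc\<close> forbids adjacent
  intervals, which would merge into one run, so the intervals are exactly the blocks of their
  union.\<close>

definition separated :: "(nat \<times> nat) list \<Rightarrow> bool" where
  "separated ps \<longleftrightarrow>
     (\<forall>p\<in>set ps. fst p \<le> snd p) \<and> sorted_wrt (\<lambda>p q. Suc (snd p) < fst q) ps"

definition intervals_union :: "(nat \<times> nat) list \<Rightarrow> nat set" where
  "intervals_union ps = (\<Union>p\<in>set ps. {fst p..snd p})"

lemma separated_Nil [simp]: "separated []"
  and separated_Cons [simp]:
    "separated (p # ps) \<longleftrightarrow>
       fst p \<le> snd p \<and> (\<forall>q\<in>set ps. Suc (snd p) < fst q) \<and> separated ps"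
  by (auto simp: separated_def)

lemma intervals_union_Nil [simp]: "intervals_union [] = {}"
  and intervals_union_Cons [simp]:
    "intervals_union (p # ps) = {fst p..snd p} \<union> intervals_union ps"
  by (auto simp: intervals_union_def)

text \<open>A new minimum either extends the first interval to the left or, if there is a hole in
  between, opens a singleton interval.\<close>

lemma ex_separated:
  assumes "finite A"
  shows "\<exists>ps. separated ps \<and> intervals_union ps = A"
  using assms
proof (induction A rule: finite_linorder_min_induct)
  case empty
  show ?case by (intro exI[of _ "[]"]) simp
next
  case (insert b A)
  then obtain ps where ps: "separated ps" "intervals_union ps = A"
    by blast
  show ?case
  proof (cases ps)
    case Nil
    with ps show ?thesis
      by (intro exI[of _ "[(b, b)]"]) auto
  next
    case (Cons p qs)
    have p: "fst p \<le> snd p" "fst p \<in> A"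
      using ps Cons by auto
    then have "b < fst p"
      using insert by auto
    have qs: "\<forall>q\<in>set qs. Suc (snd p) < fst q" "separated qs"
      using ps Cons by auto
    show ?thesis
    proof (cases "fst p = Suc b")
      case True
      then have "{b..snd p} = insert b {fst p..snd p}"
        using p by auto
      with True show ?thesis
        using ps Cons p qs
        by (intro exI[of _ "(b, snd p) # qs"]) auto
    next
      case False
      with \<open>b < fst p\<close> show ?thesis
        using ps Cons p qs
        by (intro exI[of _ "(b, b) # ps"]) fastforce
    qed
  qed
qed

lemma separated_cases:
  assumes "separated ps" "p \<in> set ps" "q \<in> set ps"
  shows "p = q \<or> Suc (snd p) < fst q \<or> Suc (snd q) < fst p"
  using assms by (induction ps) auto

lemma separated_le: "separated ps \<Longrightarrow> p \<in> set ps \<Longrightarrow> fst p \<le> snd p"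
  by (auto simp: separated_def)

text \<open>A run leaving the interval that contains its left end would contain the successor of the
  right end of that interval, which no interval covers.\<close>

lemma run_in_interval:
  assumes ps: "separated ps" and "is_run (intervals_union ps) R"
  obtains p where "p \<in> set ps" "R \<subseteq> {fst p..snd p}"
proof -
  obtain c d where R: "R = {c..d}" "c \<le> d" "{c..d} \<subseteq> intervals_union ps"
    using assms(2) unfolding is_run_def by force
  then have "c \<in> intervals_union ps"
    by auto
  then obtain p where p: "p \<in> set ps" "fst p \<le> c" "c \<le> snd p"
    unfolding intervals_union_def by auto
  have "d \<le> snd p"
  proof (rule ccontr)
    assume "\<not> d \<le> snd p"
    then have "Suc (snd p) \<in> intervals_union ps"
      using R(3) p by (meson atLeastAtMost_iff le_Suc_eq not_less_eq_eq subset_iff)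
    then obtain q where q: "q \<in> set ps" "fst q \<le> Suc (snd p)" "Suc (snd p) \<le> snd q"
      unfolding intervals_union_def by auto
    show False
      using separated_cases[OF ps p(1) q(1)] q(2,3) p(2,3) by auto
  qed
  with p R(1) show thesis
    by (intro that[of p]) auto
qed

lemma maximal_runs_intervals_union:
  assumes ps: "separated ps"
  shows "{R. is_run (intervals_union ps) R \<and>
            (\<forall>R'. is_run (intervals_union ps) R' \<and> R \<subseteq> R' \<longrightarrow> R' = R)} =
         (\<lambda>p. {fst p..snd p}) ` set ps" (is "?L = ?R")
proof -
  have run: "is_run (intervals_union ps) {fst p..snd p}" if "p \<in> set ps" for p
    using that separated_le[OF ps that] unfolding is_run_def intervals_union_def by fastforce
  show ?thesis
  proof (intro set_eqI iffI)
    fix R assume R: "R \<in> ?L"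
    then obtain p where p: "p \<in> set ps" "R \<subseteq> {fst p..snd p}"
      using run_in_interval[OF ps] by (metis (mono_tags, lifting) mem_Collect_eq)
    with R run[OF p(1)] have "{fst p..snd p} = R"
      by blast
    with p show "R \<in> ?R" by blast
  next
    fix R assume "R \<in> ?R"
    then obtain p where p: "p \<in> set ps" "R = {fst p..snd p}" by blast
    have "R' = R" if R': "is_run (intervals_union ps) R'" "R \<subseteq> R'" for R'
    proof -
      obtain q where q: "q \<in> set ps" "R' \<subseteq> {fst q..snd q}"
        using run_in_interval[OF ps R'(1)] .
      with R' p have "{fst p..snd p} \<subseteq> {fst q..snd q}" by blast
      then have "p = q"
        using separated_cases[OF ps p(1) q(1)] separated_le[OF ps p(1)]
          separated_le[OF ps q(1)] by auto
      with q R' p show ?thesis by blast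
    qed
    with run p show "R \<in> ?L" by blast
  qed
qed

lemma (in linorder) sorted_key_list_of_set_eqI:
  assumes "inj_on f (set xs)" "sorted (map f xs)" "distinct xs"
  shows "sorted_key_list_of_set f (set xs) = xs"
proof -
  \<comment> \<open>Injectivity of the key is required on \<open>set xs\<close> only. This matters
    because \<open>Min\<close> is injective on the blocks but not on all sets.\<close>
  interpret folding_insort_key "(\<le>)" "(<)" "set xs" f
    by unfold_locales (rule assms)
  show ?thesis
    using assms by (intro idem_if_sorted_distinct) auto
qed

lemma blocks_intervals_union:
  assumes ps: "separated ps"
  shows "blocks (intervals_union ps) = map (\<lambda>p. {fst p..snd p}) ps"
proof -
  let ?f = "\<lambda>p. {fst p..snd p}"
  have Min: "Min (?f p) = fst p" if "p \<in> set ps" for p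
    using separated_le[OF ps that] by (intro Min_eqI) auto
  have inj: "inj_on Min (?f ` set ps)"
  proof (rule inj_onI)
    fix X Y assume "X \<in> ?f ` set ps" "Y \<in> ?f ` set ps" "Min X = Min Y"
    then obtain p q where pq: "p \<in> set ps" "q \<in> set ps" "X = ?f p" "Y = ?f q" "fst p = fst q"
      using Min by auto
    then have "p = q"
      using separated_cases[OF ps pq(1,2)] separated_le[OF ps pq(1)]
        separated_le[OF ps pq(2)] by auto
    with pq show "X = Y" by simp
  qed
  have "map Min (map ?f ps) = map fst ps"
    using Min by simp
  moreover have "sorted_wrt (<) (map fst ps)"
    unfolding sorted_wrt_map
    using ps by (auto simp: separated_def elim!: sorted_wrt_mono_rel[rotated] dest: bspec)
  ultimately have "sorted_wrt (<) (map Min (map ?f ps))"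
    by (simp only:)
  then have sd: "sorted (map Min (map ?f ps))" "distinct (map ?f ps)"
    by (simp_all only: strict_sorted_iff distinct_map)
  show ?thesis
    using sorted_key_list_of_set_eqI[of Min "map ?f ps"] inj sd
    by (simp add: blocks_def maximal_runs_intervals_union[OF ps])
qed

section \<open>The component-wise order\<close>

lemma list_all2_le_iff_filter:
  fixes xs ys :: "'a::linorder list"
  assumes "length xs = length ys" "sorted xs" "sorted ys"
  shows "list_all2 (\<le>) xs ys \<longleftrightarrow>
    (\<forall>m. length (filter (\<lambda>y. y \<le> m) ys) \<le> length (filter (\<lambda>x. x \<le> m) xs))"
  using assms
proof (induction xs ys rule: list_induct2)
  case Nil
  show ?case by simp
next
  case (Cons x xs y ys)
  let ?c = "\<lambda>zs m. length (filter (\<lambda>z. z \<le> m) zs)"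
  have IH: "list_all2 (\<le>) xs ys \<longleftrightarrow> (\<forall>m. ?c ys m \<le> ?c xs m)"
    using Cons by auto
  have "x \<le> y \<and> (\<forall>m. ?c ys m \<le> ?c xs m)" if *: "\<forall>m. ?c (y # ys) m \<le> ?c (x # xs) m"
  proof (intro conjI allI)
    \<comment> \<open>The cutoff \<open>y\<close> counts the head of the second list, so some entry
      of the first list is at most \<open>y\<close>; by sortedness \<open>x\<close> is.\<close>
    have "?c (x # xs) y \<noteq> 0"
      using *[rule_format, of y] by auto
    then have "\<exists>z\<in>set (x # xs). z \<le> y"
      unfolding length_0_conv filter_empty_conv by blast
    then show "x \<le> y"
      using Cons.prems(1) by auto
    fix m
    show "?c ys m \<le> ?c xs m"
    proof (cases "y \<le> m")
      case True
      with \<open>x \<le> y\<close> have "x \<le> m" by simp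
      with True *[rule_format, of m] show ?thesis by simp
    next
      case False
      then have "filter (\<lambda>z. z \<le> m) ys = []"
        using Cons.prems(2) by (auto simp: filter_empty_conv)
      then show ?thesis by simp
    qed
  qed
  moreover have "\<forall>m. ?c (y # ys) m \<le> ?c (x # xs) m"
    if "x \<le> y" "\<forall>m. ?c ys m \<le> ?c xs m"
    using that by (auto intro: le_SucI)
  ultimately show ?case
    by (simp only: list_all2_Cons IH) blast
qed

lemma length_filter_sorted_list_of_set:
  assumes "finite S"
  shows "length (filter (\<lambda>x. x \<le> m) (sorted_list_of_set S)) = card (S \<inter> {..m})"
proof -
  have "set (filter (\<lambda>x. x \<le> m) (sorted_list_of_set S)) = S \<inter> {..m}"
    using assms by auto
  then show ?thesis
    by (metis distinct_card distinct_filter distinct_sorted_list_of_set)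
qed

lemma componentwise_le_iff:
  assumes "finite S" "finite T" "card S = card T"
  shows "S \<preceq> T \<longleftrightarrow> (\<forall>m. card (T \<inter> {..m}) \<le> card (S \<inter> {..m}))"
  using assms
  by (simp add: componentwise_le_def list_all2_le_iff_filter length_filter_sorted_list_of_set)

lemma card_Int_atMost_Suc:
  "finite S \<Longrightarrow> card (S \<inter> {..Suc m}) = card (S \<inter> {..m}) + (if Suc m \<in> S then 1 else 0)"
  by (simp add: atMost_Suc Int_insert_right)

text \<open>Moving left inside a block, the count of \<open>T\<close> drops by exactly one per step
  and that of \<open>S\<close> by at most one, so the inequality propagates from the block end.
  Moving right through a gap, the count of \<open>T\<close> stays constant while that of
  \<open>S\<close> cannot decrease.\<close>

lemma count_le_if_count_le_block_ends:
  assumes "finite S" "finite T" "0 \<notin> T"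
    and ends: "\<And>m. m \<in> T \<Longrightarrow> Suc m \<notin> T \<Longrightarrow> card (T \<inter> {..m}) \<le> card (S \<inter> {..m})"
  shows "card (T \<inter> {..m}) \<le> card (S \<inter> {..m})"
proof -
  have inT: "card (T \<inter> {..m}) \<le> card (S \<inter> {..m})" if "m \<in> T" for m
  proof -
    \<comment> \<open>\<open>Max T\<close> is a block end, which starts the downward
      induction.\<close>
    have "m \<le> Max T"
      using that assms(2) by simp
    then show ?thesis
      using that
    proof (induction m rule: inc_induct)
      case base
      have "Suc (Max T) \<notin> T"
        using assms(2) Max_ge not_less_eq_eq by blast
      with base ends show ?case by blast
    next
      case (step m)
      show ?case
      proof (cases "Suc m \<in> T")
        case True
        with step have "card (T \<inter> {..Suc m}) \<le> card (S \<inter> {..Suc m})"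
          by blast
        with True show ?thesis
          using assms(1,2) by (auto simp: card_Int_atMost_Suc split: if_splits)
      qed (use ends step in blast)
    qed
  qed
  show ?thesis
  proof (induction m)
    case 0
    have "T \<inter> {..0} = {}"
      using assms(3) by auto
    then show ?case by simp
  next
    case (Suc m)
    then show ?case
      using inT[of "Suc m"] assms(1,2) by (cases "Suc m \<in> T") (auto simp: card_Int_atMost_Suc)
  qed
qed

lemma mem_bases_shifted_iff:
  assumes "T \<subseteq> {1..n}" "S \<subseteq> {1..n}" "card S = card T"
  shows "S \<in> bases (shifted_matroid n T) \<longleftrightarrow> (\<forall>m. card (T \<inter> {..m}) \<le> card (S \<inter> {..m}))"
  using assms finite_subset[OF assms(1)] finite_subset[OF assms(2)]
  by (simp add: shifted_matroid_def componentwise_le_iff)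

lemma mem_bases_shifted_iff_block_ends:
  assumes "T \<subseteq> {1..n}" "S \<subseteq> {1..n}" "card S = card T"
  shows "S \<in> bases (shifted_matroid n T) \<longleftrightarrow>
    (\<forall>m\<in>{m \<in> T. Suc m \<notin> T}. card (T \<inter> {..m}) \<le> card (S \<inter> {..m}))"
proof -
  have "finite S" "finite T" "0 \<notin> T"
    using assms finite_subset by auto
  then show ?thesis
    unfolding mem_bases_shifted_iff[OF assms] using count_le_if_count_le_block_ends by blast
qed

section \<open>Separation by a weight function\<close>

text \<open>The free cutoff lets the notion apply for \<open>k = 0\<close> as well, which occurs
  when the only basis of the matroid is its set of coloops.\<close>

definition separable :: "nat \<Rightarrow> 'a set \<Rightarrow> 'a set set \<Rightarrow> bool" where
  "separable k E F \<longleftrightarrow>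
     (\<exists>(w :: 'a \<Rightarrow> real) \<theta>. \<forall>B. B \<subseteq> E \<and> card B = k \<longrightarrow> (B \<in> F \<longleftrightarrow> (\<Sum>b\<in>B. w b) > \<theta>))"

lemma separableI:
  assumes "\<And>B. B \<subseteq> E \<Longrightarrow> card B = k \<Longrightarrow> B \<in> F \<longleftrightarrow> (\<Sum>b\<in>B. w b :: real) > \<theta>"
  shows "separable k E F"
  using assms unfolding separable_def by blast

lemma separableE:
  fixes E :: "'a set"
  assumes "separable k E F"
  obtains w :: "'a \<Rightarrow> real" and \<theta> where
    "\<And>B. B \<subseteq> E \<Longrightarrow> card B = k \<Longrightarrow> B \<in> F \<longleftrightarrow> (\<Sum>b\<in>B. w b) > \<theta>"
proof -
  from assms obtain w :: "'a \<Rightarrow> real" and \<theta> where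
    "\<forall>B. B \<subseteq> E \<and> card B = k \<longrightarrow> (B \<in> F \<longleftrightarrow> (\<Sum>b\<in>B. w b) > \<theta>)"
    unfolding separable_def by (elim exE)
  then show thesis
    by (intro that[of \<theta> w]) simp
qed

lemma separable_image_iff:
  assumes f: "bij_betw f E E'" and F: "F \<subseteq> Pow E"
  shows "separable k E' ((`) f ` F) \<longleftrightarrow> separable k E F"
proof
  have inj: "inj_on f E" and E': "f ` E = E'"
    using f by (auto simp: bij_betw_def)
  have mem: "f ` B \<in> (`) f ` F \<longleftrightarrow> B \<in> F" if "B \<subseteq> E" for B
    using that inj F by (auto simp: inj_on_image_eq_iff)
  have sum: "card (f ` B) = card B" "(\<Sum>b\<in>f ` B. w b) = (\<Sum>b\<in>B. w (f b))"
    if "B \<subseteq> E" for B and w :: "'b \<Rightarrow> real"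
    using inj_on_subset[OF inj that] by (auto simp: card_image sum.reindex)
  {
    assume "separable k E' ((`) f ` F)"
    then obtain w \<theta> where
      w: "\<And>B. B \<subseteq> E' \<Longrightarrow> card B = k \<Longrightarrow> B \<in> (`) f ` F \<longleftrightarrow> (\<Sum>b\<in>B. w b :: real) > \<theta>"
      by (rule separableE) (rule that)
    show "separable k E F"
    proof (rule separableI)
      fix B assume B: "B \<subseteq> E" "card B = k"
      then show "B \<in> F \<longleftrightarrow> (\<Sum>b\<in>B. w (f b)) > \<theta>"
        using w[of "f ` B"] mem[of B] sum[of B] E' by auto
    qed
  }
  {
    assume "separable k E F"
    then obtain w \<theta> where
      w: "\<And>B. B \<subseteq> E \<Longrightarrow> card B = k \<Longrightarrow> B \<in> F \<longleftrightarrow> (\<Sum>b\<in>B. w b :: real) > \<theta>"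
      by (rule separableE) (rule that)
    show "separable k E' ((`) f ` F)"
    proof (rule separableI)
      fix B' assume B': "B' \<subseteq> E'" "card B' = k"
      then obtain B where B: "B \<subseteq> E" "B' = f ` B"
        using E' by (metis subset_image_iff)
      have "(\<Sum>b\<in>B'. w (inv_into E f b)) = (\<Sum>b\<in>B. w b)"
        using B inj by (auto simp: sum intro!: sum.cong)
      then show "B' \<in> (`) f ` F \<longleftrightarrow> (\<Sum>b\<in>B'. w (inv_into E f b)) > \<theta>"
        using w[of B] B B' mem[of B] sum[of B] by auto
    qed
  }
qed

text \<open>The coloops receive such a large weight that a set missing one of them is never
  separated from the nonbases; a uniform shift of all weights moves the cutoff to \<open>0\<close>.\<close>

lemma threshold_iff_separable:
  fixes M :: "'a matroid"
  defines "C \<equiv> coloops M"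
  assumes fin: "finite (ground M)" and sub: "bases M \<subseteq> Pow (ground M)"
    and r: "rank M = k + card C" and pos: "rank M > 0"
  shows "threshold M \<longleftrightarrow> separable k (ground M - C) ((\<lambda>B. B - C) ` bases M)"
proof
  let ?E = "ground M - C" and ?F = "(\<lambda>B. B - C) ` bases M"
  have CE: "C \<subseteq> ground M" and CB: "\<And>B. B \<in> bases M \<Longrightarrow> C \<subseteq> B"
    unfolding C_def coloops_def by auto
  then have finC: "finite C"
    using fin finite_subset by blast
  have mem: "B \<in> ?F \<longleftrightarrow> B \<union> C \<in> bases M" if B: "B \<subseteq> ?E" for B
  proof
    assume "B \<in> ?F"
    then obtain B' where "B' \<in> bases M" "B = B' - C" by blast
    with CB have "B \<union> C = B'" by blast
    with \<open>B' \<in> bases M\<close> show "B \<union> C \<in> bases M" by simp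
  next
    assume "B \<union> C \<in> bases M"
    moreover have "B = (B \<union> C) - C" using B by auto
    ultimately show "B \<in> ?F" by blast
  qed
  have dec: "card (B \<union> C) = card B + card C" "(\<Sum>b\<in>B \<union> C. w b) = (\<Sum>b\<in>B. w b) + (\<Sum>b\<in>C. w b)"
    if "B \<subseteq> ?E" for B and w :: "'a \<Rightarrow> real"
  proof -
    have "finite B" "B \<inter> C = {}"
      using that fin finite_subset by auto
    then show "card (B \<union> C) = card B + card C"
      "(\<Sum>b\<in>B \<union> C. w b) = (\<Sum>b\<in>B. w b) + (\<Sum>b\<in>C. w b)"
      using finC by (auto simp: card_Un_disjoint sum.union_disjoint)
  qed
  {
    assume "threshold M"
    then obtain w :: "'a \<Rightarrow> real" where
      w: "\<And>B. B \<subseteq> ground M \<Longrightarrow> card B = rank M \<Longrightarrow> B \<in> bases M \<longleftrightarrow> (\<Sum>b\<in>B. w b) > 0"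
      unfolding threshold_def by blast
    show "separable k ?E ?F"
    proof (rule separableI)
      fix B assume B: "B \<subseteq> ?E" "card B = k"
      have "B \<union> C \<in> bases M \<longleftrightarrow> (\<Sum>b\<in>B \<union> C. w b) > 0"
        using B CE r dec(1)[OF B(1)] by (intro w) auto
      then show "B \<in> ?F \<longleftrightarrow> (\<Sum>b\<in>B. w b) > - (\<Sum>b\<in>C. w b)"
        unfolding mem[OF B(1)] dec(2)[OF B(1)] by linarith
    qed
  }
  {
    assume "separable k ?E ?F"
    then obtain w :: "'a \<Rightarrow> real" and \<theta> where
      w: "\<And>B. B \<subseteq> ?E \<Longrightarrow> card B = k \<Longrightarrow> B \<in> ?F \<longleftrightarrow> (\<Sum>b\<in>B. w b) > \<theta>"
      by (rule separableE) (rule that)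
    \<comment> \<open>No weight sum over noncoloops exceeds the cutoff by more than
      \<open>L\<close>, so losing a single coloop already makes the shifted total
      nonpositive.\<close>
    define L where "L = (\<Sum>b\<in>?E. \<bar>w b\<bar>) + \<bar>\<theta>\<bar>"
    have "L \<ge> 0"
      unfolding L_def by (simp add: sum_nonneg)
    \<comment> \<open>Subtracted \<open>rank M\<close> times, \<open>s\<close> removes exactly the
      total weight of the coloops and the cutoff.\<close>
    define s where "s = (card C * L + \<theta>) / rank M"
    define u where "u = (\<lambda>b. (if b \<in> C then L else w b) - s)"
    have "B \<in> bases M \<longleftrightarrow> (\<Sum>b\<in>B. u b) > 0" if B: "B \<subseteq> ground M" "card B = rank M" for B
    proof -
      have finB: "finite B"
        using B fin finite_subset by blast
      have "(\<Sum>b\<in>B. u b) = (\<Sum>b\<in>B. if b \<in> C then L else w b) - rank M * s"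
        unfolding u_def using B by (simp add: sum_subtractf)
      also have "rank M * s = card C * L + \<theta>"
        unfolding s_def using pos by simp
      also have "(\<Sum>b\<in>B. if b \<in> C then L else w b) = card (B \<inter> C) * L + (\<Sum>b\<in>B - C. w b)"
        using finB by (simp add: sum.If_cases Diff_eq)
      finally have u: "(\<Sum>b\<in>B. u b) =
        (\<Sum>b\<in>B - C. w b) - \<theta> - (real (card C) - real (card (B \<inter> C))) * L"
        by (simp add: algebra_simps)
      show ?thesis
      proof (cases "C \<subseteq> B")
        case True
        then have "B \<inter> C = C" "B - C \<union> C = B" by auto
        moreover have "card (B - C) = k"
          using True finC B r by (simp add: card_Diff_subset)
        ultimately show ?thesis
          using w[of "B - C"] mem[of "B - C"] u B by auto
      next
        case False
        have "B \<inter> C \<subset> C"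
          using False by blast
        then have "card (B \<inter> C) < card C"
          by (rule psubset_card_mono[OF finC])
        then have "1 * L \<le> (real (card C) - real (card (B \<inter> C))) * L"
          using \<open>L \<ge> 0\<close> by (intro mult_right_mono) auto
        moreover have "(\<Sum>b\<in>B - C. w b) \<le> (\<Sum>b\<in>B - C. \<bar>w b\<bar>)"
          by (intro sum_mono) auto
        moreover have "(\<Sum>b\<in>B - C. \<bar>w b\<bar>) \<le> (\<Sum>b\<in>?E. \<bar>w b\<bar>)"
          using B fin by (intro sum_mono2) auto
        ultimately have "\<not> (\<Sum>b\<in>B. u b) > 0"
          unfolding u using L_def by linarith
        with False CB show ?thesis by blast
      qed
    qed
    then show "threshold M"
      unfolding threshold_def by blast
  }
qed

section \<open>Weights constant on three intervals, with a penalty for loops\<close>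

lemma sum_three_levels:
  fixes \<alpha> \<beta> \<gamma> :: real and S :: "nat set"
  assumes "finite S" "b1 \<le> b2"
  shows "(\<Sum>i\<in>S. if i \<le> b1 then \<alpha> else if i \<le> b2 then \<beta> else \<gamma>) =
    \<alpha> * card (S \<inter> {..b1}) + \<beta> * (real (card (S \<inter> {..b2})) - card (S \<inter> {..b1}))
      + \<gamma> * (real (card S) - card (S \<inter> {..b2}))"
  using assms by (induction S) (auto simp: Int_insert_left algebra_simps)

text \<open>Reduces separation to one linear inequality in the counts \<open>x\<close> up to
  \<open>b1\<close> and \<open>y\<close> up to \<open>b2\<close>. It is required only for pairs that
  can occur; in particular \<open>y - x\<close> is at most \<open>b2 - b1\<close>, the number of
  integers available.\<close>

lemma separable_three_levels:
  fixes \<alpha> \<beta> \<gamma> \<theta> :: real and b1 b2 e n :: nat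
  assumes b: "b1 \<le> b2"
    and F: "\<And>S. S \<subseteq> {1..n} \<Longrightarrow> card S = k \<Longrightarrow>
      S \<in> F \<longleftrightarrow> S \<subseteq> {..e} \<and> P (card (S \<inter> {..b1})) (card (S \<inter> {..b2}))"
    and P: "\<And>x y. x \<le> y \<Longrightarrow> y \<le> k \<Longrightarrow> y \<le> x + (b2 - b1) \<Longrightarrow>
      P x y \<longleftrightarrow> \<alpha> * x + \<beta> * (real y - x) + \<gamma> * (real k - y) > \<theta>"
  shows "separable k {1..n} F"
proof -
  define w where "w = (\<lambda>i. if i \<le> b1 then \<alpha> else if i \<le> b2 then \<beta> else \<gamma>)"
  \<comment> \<open>A single element beyond \<open>e\<close>, of weight \<open>- L\<close>, pulls
    the total down to at most \<open>- \<bar>\<theta>\<bar>\<close>, hence to at most the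
    cutoff.\<close>
  define L where "L = (\<Sum>i\<in>{1..n}. \<bar>w i\<bar>) + \<bar>\<theta>\<bar>"
  have "L \<ge> 0"
    unfolding L_def by (simp add: sum_nonneg)
  show ?thesis
  proof (rule separableI)
    fix S assume S: "S \<subseteq> {1..n}" "card S = k"
    then have fin: "finite S"
      using finite_subset by blast
    show "S \<in> F \<longleftrightarrow> (\<Sum>i\<in>S. if i \<le> e then w i else - L) > \<theta>"
    proof (cases "S \<subseteq> {..e}")
      case True
      have "S \<inter> {..b2} = S \<inter> {..b1} \<union> S \<inter> {b1<..b2}"
        using b by auto
      then have "card (S \<inter> {..b2}) \<le> card (S \<inter> {..b1}) + card (S \<inter> {b1<..b2})"
        by (simp add: card_Un_le)
      also have "card (S \<inter> {b1<..b2}) \<le> card {b1<..b2}"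
        by (intro card_mono) auto
      finally have "card (S \<inter> {..b2}) \<le> card (S \<inter> {..b1}) + (b2 - b1)"
        by simp
      moreover have "card (S \<inter> {..b1}) \<le> card (S \<inter> {..b2})" "card (S \<inter> {..b2}) \<le> k"
        using fin b S by (auto intro!: card_mono)
      ultimately have "S \<in> F \<longleftrightarrow> (\<Sum>i\<in>S. w i) > \<theta>"
        using F[OF S] P True sum_three_levels[OF fin b] S unfolding w_def by simp
      moreover have "(\<Sum>i\<in>S. if i \<le> e then w i else - L) = (\<Sum>i\<in>S. w i)"
        using True by (intro sum.cong) auto
      ultimately show ?thesis by simp
    next
      case False
      then obtain j where j: "j \<in> S" "\<not> j \<le> e" by auto
      have "(\<Sum>i\<in>S. if i \<le> e then w i else - L) = - L + (\<Sum>i\<in>S - {j}. if i \<le> e then w i else - L)"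
        using sum.remove[OF fin j(1), of "\<lambda>i. if i \<le> e then w i else - L"] j by simp
      also have "(\<Sum>i\<in>S - {j}. if i \<le> e then w i else - L) \<le> (\<Sum>i\<in>S - {j}. \<bar>w i\<bar>)"
        using \<open>L \<ge> 0\<close> by (intro sum_mono) auto
      also have "\<dots> \<le> (\<Sum>i\<in>{1..n}. \<bar>w i\<bar>)"
        using S by (intro sum_mono2) auto
      finally have "\<not> (\<Sum>i\<in>S. if i \<le> e then w i else - L) > \<theta>"
        unfolding L_def by linarith
      with F[OF S] False show ?thesis by blast
    qed
  qed
qed

section \<open>Shifted matroids without coloops\<close>

text \<open>Since \<open>T\<close> and \<open>Q = T - {a, d, e, c} \<union> {x, p, q, y}\<close> are bases while
  \<open>T - {a, c} \<union> {p, q}\<close> and \<open>T - {d, e} \<union> {x, y}\<close> are not, and both pairs have the same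
  multiset union, no weight function separates bases from nonbases.\<close>

lemma not_separable_shifted:
  assumes T: "T \<subseteq> {1..n}"
    and inT: "a \<in> T" "d \<in> T" "e \<in> T" "c \<in> T"
    and notT: "x \<notin> T" "p \<notin> T" "q \<notin> T" "y \<notin> T"
    and ord: "1 \<le> x" "x < a" "a < p" "p < q" "p < d" "d < e" "q < e" "e < y" "y < c"
  shows "\<not> separable (card T) {1..n} (bases (shifted_matroid n T))"
proof
  let ?F = "bases (shifted_matroid n T)"
  assume "separable (card T) {1..n} ?F"
  then obtain w \<theta> where
    w: "\<And>B. B \<subseteq> {1..n} \<Longrightarrow> card B = card T \<Longrightarrow> B \<in> ?F \<longleftrightarrow> (\<Sum>b\<in>B. w b :: real) > \<theta>"
    by (rule separableE) (rule that)
  define R where "R = T - {a, d, e, c}"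
  have neq: "d \<noteq> q"
    using inT notT by auto
  have fin: "finite R"
    unfolding R_def using T finite_subset by auto
  have R: "a \<notin> R" "d \<notin> R" "e \<notin> R" "c \<notin> R" "x \<notin> R" "p \<notin> R" "q \<notin> R" "y \<notin> R"
    unfolding R_def using notT by auto
  have Teq: "T = insert a (insert d (insert e (insert c R)))"
    unfolding R_def using inT by auto
  define A where "A = insert p (insert q (insert d (insert e R)))"
  define B where "B = insert x (insert y (insert a (insert c R)))"
  define Q where "Q = insert x (insert p (insert q (insert y R)))"
  have sub: "A \<subseteq> {1..n}" "B \<subseteq> {1..n}" "Q \<subseteq> {1..n}"
    using T inT ord unfolding A_def B_def Q_def R_def by auto
  have card: "card A = card T" "card B = card T" "card Q = card T"
    unfolding Teq A_def B_def Q_def using R fin ord neq by auto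
  have "T \<in> ?F"
    using mem_bases_shifted_iff[OF T T] by simp
  \<comment> \<open>Passing from \<open>T\<close> to \<open>Q\<close> replaces \<open>a\<close>,
    \<open>d\<close>, \<open>e\<close>, \<open>c\<close> by the smaller \<open>x\<close>,
    \<open>p\<close>, \<open>q\<close>, \<open>y\<close>, respectively.\<close>
  moreover have "Q \<in> ?F"
    unfolding mem_bases_shifted_iff[OF T sub(3) card(3)]
    unfolding Teq Q_def using R fin ord neq by (auto simp: Int_insert_left)
  moreover have "A \<notin> ?F"
  proof -
    \<comment> \<open>Up to \<open>a\<close>, the element \<open>a\<close> is lost, and
      \<open>p\<close> and \<open>q\<close> come too late to replace it.\<close>
    have "card (A \<inter> {..a}) < card (T \<inter> {..a})"
      unfolding Teq A_def using R fin ord neq by (auto simp: Int_insert_left)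
    then show ?thesis
      unfolding mem_bases_shifted_iff[OF T sub(1) card(1)] using not_le by blast
  qed
  moreover have "B \<notin> ?F"
  proof -
    \<comment> \<open>Up to \<open>e\<close>, both \<open>d\<close> and \<open>e\<close> are lost
      and only \<open>x\<close> is gained.\<close>
    have "card (B \<inter> {..e}) < card (T \<inter> {..e})"
      unfolding Teq B_def using R fin ord neq by (auto simp: Int_insert_left)
    then show ?thesis
      unfolding mem_bases_shifted_iff[OF T sub(2) card(2)] using not_le by blast
  qed
  moreover have "sum w A + sum w B = sum w T + sum w Q"
    unfolding Teq A_def B_def Q_def using R fin ord neq by simp
  ultimately show False
    using w[OF T] w[OF sub(1) card(1)] w[OF sub(2) card(2)] w[OF sub(3) card(3)] by auto
qed

section \<open>Separating weights for at most three blocks\<close>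

lemma separable_shifted_empty: "separable 0 {1..n} (bases (shifted_matroid n {}))"
proof (rule separableI)
  fix B :: "nat set"
  assume "B \<subseteq> {1..n}" "card B = 0"
  then have "B = {}"
    by (meson card_0_eq finite_atLeastAtMost finite_subset)
  \<comment> \<open>The negative cutoff lets the empty sum pass.\<close>
  then show "B \<in> bases (shifted_matroid n {}) \<longleftrightarrow> (\<Sum>b\<in>B. 0) > (- 1 :: real)"
    by (simp add: shifted_matroid_def componentwise_le_def)
qed

lemma card_le_card_Int_iff:
  "finite S \<Longrightarrow> card S \<le> card (S \<inter> A) \<longleftrightarrow> S \<subseteq> A"
  by (metis Int_absorb2 Int_lower1 card_seteq inf.absorb_iff1 order_refl)

lemma separable_shifted_one_block:
  assumes T: "{a..b} \<subseteq> {1..n}" and ab: "a \<le> b"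
  shows "separable (card {a..b}) {1..n} (bases (shifted_matroid n {a..b}))"
\<comment> \<open>Only loops have to be excluded: all three levels are 0 and the cutoff is
  negative.\<close>
proof (rule separable_three_levels[where ?b1.0 = 0 and ?b2.0 = 0 and e = b
      and P = "\<lambda>_ _. True" and \<alpha> = 0 and \<beta> = 0 and \<gamma> = 0 and \<theta> = "- 1"])
  fix S assume S: "S \<subseteq> {1..n}" "card S = card {a..b}"
  then have "finite S"
    using finite_subset by blast
  have "{a..b} \<inter> {..b} = {a..b}"
    by auto
  moreover have "{m \<in> {a..b}. Suc m \<notin> {a..b}} = {b}"
    using ab by auto
  ultimately have "S \<in> bases (shifted_matroid n {a..b}) \<longleftrightarrow> card S \<le> card (S \<inter> {..b})"
    unfolding mem_bases_shifted_iff_block_ends[OF T S] S(2) by simp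
  then show "S \<in> bases (shifted_matroid n {a..b}) \<longleftrightarrow> S \<subseteq> {..b} \<and> True"
    using card_le_card_Int_iff[OF \<open>finite S\<close>] by blast
qed auto

lemma separable_shifted_two_blocks:
  fixes a1 b1 a2 b2 n :: nat
  defines "T \<equiv> {a1..b1} \<union> {a2..b2}"
  assumes T: "T \<subseteq> {1..n}" and ord: "a1 \<le> b1" "Suc b1 < a2" "a2 \<le> b2"
  shows "separable (card T) {1..n} (bases (shifted_matroid n T))"
\<comment> \<open>The total is the count up to \<open>b1\<close>; subtracting one half makes the
  integer bound a strict one.\<close>
proof (rule separable_three_levels[where ?b1.0 = b1 and ?b2.0 = b1 and e = b2
      and P = "\<lambda>x _. card {a1..b1} \<le> x"
      and \<alpha> = 1 and \<beta> = 0 and \<gamma> = 0 and \<theta> = "card {a1..b1} - 1 / 2"])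
  fix S assume S: "S \<subseteq> {1..n}" "card S = card T"
  then have "finite S"
    using finite_subset by blast
  have "T \<inter> {..b2} = T" "T \<inter> {..b1} = {a1..b1}"
    unfolding T_def using ord by auto
  moreover have "{m \<in> T. Suc m \<notin> T} = {b1, b2}"
    unfolding T_def using ord by auto
  ultimately have "S \<in> bases (shifted_matroid n T) \<longleftrightarrow>
      card {a1..b1} \<le> card (S \<inter> {..b1}) \<and> card S \<le> card (S \<inter> {..b2})"
    unfolding mem_bases_shifted_iff_block_ends[OF T S] S(2) by simp
  then show "S \<in> bases (shifted_matroid n T) \<longleftrightarrow>
      S \<subseteq> {..b2} \<and> card {a1..b1} \<le> card (S \<inter> {..b1})"
    using card_le_card_Int_iff[OF \<open>finite S\<close>] by blast
qed auto

text \<open>With \<open>x\<close> elements up to \<open>b1\<close> and \<open>y\<close> elements up to \<open>b2\<close>, the two inequalities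
  defining a basis amount to a lexicographic condition: if the second block is a singleton
  it is \<open>(x, y - x) \<ge> (d1, 1)\<close>, and if the second gap is a singleton it is
  \<open>(k - y, y - x) \<le> (d3, d2)\<close>, where \<open>d1, d2, d3\<close> are the block sizes
  and \<open>k = card T\<close>.\<close>

lemma separable_shifted_three_blocks:
  fixes a1 b1 a2 b2 a3 b3 n :: nat
  defines "T \<equiv> {a1..b1} \<union> {a2..b2} \<union> {a3..b3}"
  assumes T: "T \<subseteq> {1..n}"
    and ord: "a1 \<le> b1" "Suc b1 < a2" "a2 \<le> b2" "Suc b2 < a3" "a3 \<le> b3"
    and one: "a2 = b2 \<or> a2 = Suc (Suc b1)"
  shows "separable (card T) {1..n} (bases (shifted_matroid n T))"
proof -
  define d1 d2 d3 where d: "d1 = card {a1..b1}" "d2 = card {a2..b2}" "d3 = card {a3..b3}"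
  define D where "D = b2 - b1"
  have "card T = card ({a1..b1} \<union> {a2..b2}) + d3" and T2: "card ({a1..b1} \<union> {a2..b2}) = d1 + d2"
    unfolding T_def d using ord by (subst card_Un_disjoint; force)+
  then have cT: "card T = d1 + d2 + d3"
    by simp
  define P where "P = (\<lambda>x y. d1 \<le> x \<and> d1 + d2 \<le> y)"
  have F: "S \<in> bases (shifted_matroid n T) \<longleftrightarrow>
      S \<subseteq> {..b3} \<and> P (card (S \<inter> {..b1})) (card (S \<inter> {..b2}))"
    if S: "S \<subseteq> {1..n}" "card S = card T" for S
  proof -
    have "finite S"
      using S finite_subset by blast
    have "T \<inter> {..b3} = T" "T \<inter> {..b2} = {a1..b1} \<union> {a2..b2}" "T \<inter> {..b1} = {a1..b1}"
      unfolding T_def using ord by auto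
    then have "card (T \<inter> {..b3}) = card S" "card (T \<inter> {..b2}) = d1 + d2" "card (T \<inter> {..b1}) = d1"
      using S T2 d by auto
    moreover have "{m \<in> T. Suc m \<notin> T} = {b1, b2, b3}"
      unfolding T_def using ord by auto
    ultimately have "S \<in> bases (shifted_matroid n T) \<longleftrightarrow>
        d1 \<le> card (S \<inter> {..b1}) \<and> d1 + d2 \<le> card (S \<inter> {..b2}) \<and> card S \<le> card (S \<inter> {..b3})"
      unfolding mem_bases_shifted_iff_block_ends[OF T S] by simp
    then show ?thesis
      using card_le_card_Int_iff[OF \<open>finite S\<close>] unfolding P_def by blast
  qed
  have b12: "b1 \<le> b2"
    using ord by simp
  from one show ?thesis
  proof
    assume "a2 = b2"
    then have d2: "d2 = 1"
      by (simp add: d)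
    show ?thesis
    \<comment> \<open>Since \<open>y - x\<close> is at most \<open>D\<close>, weight
      \<open>D\<close> for each element counted by \<open>x\<close> gives it lexicographic priority:
      with \<open>x < d1\<close> the total is at most \<open>D * d1\<close>, just short of the
      required \<open>D * d1 + 1\<close>.\<close>
    proof (rule separable_three_levels[OF b12 F,
          where \<alpha> = "D" and \<beta> = 1 and \<gamma> = 0 and \<theta> = "real (D * d1) + 1 / 2"])
      fix x y :: nat
      assume xy: "x \<le> y" "y \<le> card T" "y \<le> x + (b2 - b1)"
      consider "x < d1" | "x = d1" | "d1 < x" by linarith
      then have "P x y \<longleftrightarrow> D * d1 + 1 \<le> D * x + (y - x)"
      proof cases
        case 1
        then have "D * (x + 1) \<le> D * d1"
          by (intro mult_le_mono2) simp
        then show ?thesis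
          using 1 xy unfolding P_def D_def by simp
      next
        case 2
        then show ?thesis
          using xy d2 unfolding P_def by auto
      next
        \<comment> \<open>Here \<open>P\<close> holds outright, because \<open>y\<close> is at least
          \<open>x\<close> and \<open>x\<close> is at least \<open>d1 + 1 = d1 + d2\<close>.\<close>
        case 3
        then have "D * (d1 + 1) \<le> D * x"
          by (intro mult_le_mono2) simp
        moreover have "D \<ge> 1"
          unfolding D_def using ord by simp
        ultimately have "D * d1 + 1 \<le> D * x + (y - x)"
          by simp
        then show ?thesis
          using 3 xy d2 unfolding P_def by auto
      qed
      also have "\<dots> \<longleftrightarrow> real (D * x + (y - x)) > real (D * d1) + 1 / 2"
        by linarith
      finally show "P x y \<longleftrightarrow>
          real D * x + 1 * (real y - x) + 0 * (real (card T) - y) > real (D * d1) + 1 / 2"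
        using xy(1) by (simp add: of_nat_diff add_diff_eq)
    qed
  next
    assume "a2 = Suc (Suc b1)"
    \<comment> \<open>Between \<open>b1\<close> and \<open>b2\<close> lie the second block and the
      single element of the second gap.\<close>
    then have D: "D = d2 + 1"
      using ord by (simp add: d D_def)
    show ?thesis
    proof (rule separable_three_levels[OF b12 F,
          where \<alpha> = 0 and \<beta> = "- 1" and \<gamma> = "- real D" and \<theta> = "- real (D * d3 + d2) - 1 / 2"])
      fix x y :: nat
      assume xy: "x \<le> y" "y \<le> card T" "y \<le> x + (b2 - b1)"
      \<comment> \<open>\<open>v\<close> counts the elements beyond \<open>b2\<close> and
        \<open>z\<close> those after \<open>b1\<close> up to \<open>b2\<close>; in these terms the
        conditions become upper bounds.\<close>
      define z v where zv: "z = y - x" "v = card T - y"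
      have zv': "real z = real y - real x" "real v = real (card T) - real y"
        unfolding zv using xy by (simp_all add: of_nat_diff)
      have P: "P x y \<longleftrightarrow> v \<le> d3 \<and> v + z \<le> d2 + d3" and z: "z \<le> D"
        using xy cT unfolding P_def zv D_def by auto
      consider "v < d3" | "v = d3" | "d3 < v" by linarith
      then have "P x y \<longleftrightarrow> D * v + z \<le> D * d3 + d2"
      proof cases
        \<comment> \<open>Both sides hold: \<open>z\<close> exceeds \<open>d2\<close> by at most
          one, and \<open>v\<close> being smaller than \<open>d3\<close> makes up for it.\<close>
        case 1
        then have "D * (v + 1) \<le> D * d3"
          by (intro mult_le_mono2) simp
        then show ?thesis
          using 1 z D unfolding P by simp
      next
        case 2
        then show ?thesis
          unfolding P by simp
      next
        case 3
        then have "D * (d3 + 1) \<le> D * v"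
          by (intro mult_le_mono2) simp
        then show ?thesis
          using 3 D unfolding P by simp
      qed
      also have "\<dots> \<longleftrightarrow> - real (D * v + z) > - real (D * d3 + d2) - 1 / 2"
        by linarith
      finally show "P x y \<longleftrightarrow>
          0 * real x + - 1 * (real y - x) + - real D * (real (card T) - y) > - real (D * d3 + d2) - 1 / 2"
        using zv' by simp
    qed
  qed
qed

section \<open>Obstructions for three or more blocks, and the second gap\<close>

lemma Suc_snd_notin_intervals_union:
  assumes "separated ps" "p \<in> set ps"
  shows "Suc (snd p) \<notin> intervals_union ps"
proof
  assume "Suc (snd p) \<in> intervals_union ps"
  then obtain q where q: "q \<in> set ps" "fst q \<le> Suc (snd p)" "Suc (snd p) \<le> snd q"
    unfolding intervals_union_def by auto
  show False
    using separated_cases[OF assms q(1)] separated_le[OF assms] q by auto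
qed

lemma ends_in_intervals_union:
  assumes "separated ps" "p \<in> set ps"
  shows "fst p \<in> intervals_union ps" "snd p \<in> intervals_union ps"
  using assms(2) separated_le[OF assms] unfolding intervals_union_def by fastforce+

text \<open>The exchanged elements of \<open>T\<close> are the end of the first block and the starts
  of the next three. They are traded for 1, which lies in the first gap, and the points just after
  the first three blocks.\<close>

lemma not_separable_four_blocks:
  assumes "separated (p # q # r # s # ps)"
    and T: "T = intervals_union (p # q # r # s # ps)" "T \<subseteq> {1..n}" "1 \<notin> T"
  shows "\<not> separable (card T) {1..n} (bases (shifted_matroid n T))"
proof -
  note ends = ends_in_intervals_union[OF assms(1), folded T(1)]
  note Suc_end = Suc_snd_notin_intervals_union[OF assms(1), folded T(1)]
  have "snd p \<in> T" "fst q \<in> T" "fst r \<in> T" "fst s \<in> T"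
    "Suc (snd p) \<notin> T" "Suc (snd q) \<notin> T" "Suc (snd r) \<notin> T"
    by (intro ends Suc_end; simp)+
  moreover have "snd p \<noteq> 1" "snd p \<ge> 1"
    using \<open>snd p \<in> T\<close> T(2,3) by auto
  ultimately show ?thesis
    using assms(1)
    by (intro not_separable_shifted[OF T(2), where x = 1 and a = "snd p" and p = "Suc (snd p)"
          and d = "fst q" and q = "Suc (snd q)" and e = "fst r" and y = "Suc (snd r)"
          and c = "fst s"] T(3)) auto
qed

text \<open>Here \<open>d\<close> and \<open>e\<close> are the two ends of the second block, and
  \<open>p\<close> and \<open>q\<close> those of the second gap; \<open>big\<close> makes them
  distinct.\<close>

lemma not_separable_three_blocks:
  assumes "separated [p, q, r]"
    and T: "T = intervals_union [p, q, r]" "T \<subseteq> {1..n}" "1 \<notin> T"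
    and big: "fst q \<noteq> snd q" "fst q \<noteq> Suc (Suc (snd p))"
  shows "\<not> separable (card T) {1..n} (bases (shifted_matroid n T))"
proof -
  note ends = ends_in_intervals_union[OF assms(1), folded T(1)]
  note Suc_end = Suc_snd_notin_intervals_union[OF assms(1), folded T(1)]
  have inT: "snd p \<in> T" "fst q \<in> T" "snd q \<in> T" "fst r \<in> T"
    "Suc (snd p) \<notin> T" "Suc (snd q) \<notin> T"
    by (intro ends Suc_end; simp)+
  have ord: "fst p \<le> snd p" "Suc (snd p) < fst q" "fst q \<le> snd q" "Suc (snd q) < fst r"
    using assms(1) by auto
  then have "fst q - 1 \<notin> T"
    unfolding T(1) by auto
  moreover have "snd p \<noteq> 1" "snd p \<ge> 1"
    using inT T(2,3) by auto
  ultimately show ?thesis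
    using inT ord big
    by (intro not_separable_shifted[OF T(2), where x = 1 and a = "snd p" and p = "Suc (snd p)"
          and d = "fst q" and q = "fst q - 1" and e = "snd q" and y = "Suc (snd q)"
          and c = "fst r"] T(3)) auto
qed

lemma second_gap_three_blocks:
  assumes "separated [p, q, r]"
    and T: "T = intervals_union [p, q, r]" "T \<subseteq> {1..n}" "1 \<notin> T"
  shows "gaps n T ! 1 = {Suc (snd p)..fst q - 1}"
proof -
  note ends = ends_in_intervals_union[OF assms(1), folded T(1)]
  have inT: "fst p \<in> T" "snd r \<in> T"
    by (intro ends; simp)+
  then have fp: "fst p \<ge> 1" "fst p \<noteq> 1" "snd r \<le> n"
    using T(2,3) by auto
  have ord: "fst p \<le> snd p" "Suc (snd p) < fst q" "fst q \<le> snd q" "Suc (snd q) < fst r"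
      "fst r \<le> snd r"
    using assms(1) by auto
  \<comment> \<open>Since 1 is not in \<open>T\<close>, the first gap is nonempty, so index 1 is the
    gap between the first two blocks. A gap after the last block exists only if \<open>T\<close>
    stops before \<open>n\<close>.\<close>
  define gs where "gs = [(1, fst p - 1), (Suc (snd p), fst q - 1), (Suc (snd q), fst r - 1)] @
    (if snd r < n then [(Suc (snd r), n)] else [])"
  have "separated gs"
    unfolding gs_def using ord fp by auto
  moreover have "intervals_union gs = {1..n} - T"
    unfolding gs_def T(1) using ord fp by auto
  ultimately show ?thesis
    using blocks_intervals_union[of gs] unfolding gaps_def gs_def by simp
qed

section \<open>Contracting the coloops\<close>

text \<open>Every basis contains all coloops, so each one attains the maximal intersection.\<close>

lemma bases_contract_coloops:
  assumes "finite (ground M)"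
  shows "bases (contract M (coloops M)) = (\<lambda>B. B - coloops M) ` bases M"
proof -
  have "B \<inter> coloops M = coloops M" if "B \<in> bases M" for B
    using that unfolding coloops_def by auto
  then show ?thesis
    unfolding contract_def by auto
qed

text \<open>This makes 1 a coloop of the shifted matroid whenever it lies in \<open>T\<close>, which
  is impossible once the coloops have been contracted.\<close>

lemma one_in_basis_shifted:
  assumes T: "T \<subseteq> {1..n}" "1 \<in> T" and S: "S \<in> bases (shifted_matroid n T)"
  shows "1 \<in> S"
proof -
  have S': "S \<subseteq> {1..n}" "card S = card T"
    using S unfolding shifted_matroid_def by auto
  have "card (T \<inter> {..1}) \<le> card (S \<inter> {..1})"
    using S mem_bases_shifted_iff[OF T(1) S'] by blast
  moreover have "card (T \<inter> {..1}) > 0"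
    using T(2) by (auto simp: card_gt_0_iff)
  ultimately obtain i where "i \<in> S" "i \<le> 1"
    by (metis Int_iff atMost_iff card.empty ex_in_conv leD)
  then show ?thesis
    using S'(1) by (metis atLeastAtMost_iff le_antisym subsetD)
qed

lemma threshold_iff_separable_shifted:
  assumes M: "is_matroid M" "rank M > 0" and T: "T \<subseteq> {1..n}"
    and iso: "isomorphic (contract M (coloops M)) (shifted_matroid n T)"
  shows "threshold M \<longleftrightarrow> separable (card T) {1..n} (bases (shifted_matroid n T))"
    and "1 \<notin> T"
proof -
  let ?C = "coloops M"
  let ?E = "ground M - ?C" and ?F = "(\<lambda>B. B - ?C) ` bases M"
  have fin: "finite (ground M)" and sub: "bases M \<subseteq> Pow (ground M)"
    using M unfolding is_matroid_def by auto
  obtain f where f: "bij_betw f ?E {1..n}" and F: "bases (shifted_matroid n T) = (`) f ` ?F"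
    using iso fin unfolding isomorphic_def bases_contract_coloops[OF fin]
    by (auto simp: contract_def shifted_matroid_def)
  have FE: "?F \<subseteq> Pow ?E"
    using sub by auto
  have CB: "?C \<subseteq> B" if "B \<in> bases M" for B
    using that unfolding coloops_def by auto
  have fC: "finite ?C"
    using fin unfolding coloops_def by simp
  have card: "card B = card T + card ?C" if B: "B \<in> bases M" for B
  proof -
    have "f ` (B - ?C) \<in> bases (shifted_matroid n T)"
      using B F by blast
    then have "card (f ` (B - ?C)) = card T"
      unfolding shifted_matroid_def by simp
    moreover have "inj_on f (B - ?C)"
      using f B sub by (auto simp: bij_betw_def intro: inj_on_subset)
    ultimately have "card (B - ?C) = card T"
      by (simp add: card_image)
    moreover have "finite B"
      using B sub fin finite_subset by blast
    ultimately show ?thesis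
      using CB[OF B] fC card_mono[of B ?C] by (simp add: card_Diff_subset)
  qed
  have "bases M \<noteq> {}"
    using M unfolding is_matroid_def by auto
  then have "card ` bases M = {card T + card ?C}"
    using card by auto
  then have "rank M = card T + card ?C"
    by (simp add: rank_def)
  then show "threshold M \<longleftrightarrow> separable (card T) {1..n} (bases (shifted_matroid n T))"
    unfolding F separable_image_iff[OF f FE]
    by (intro threshold_iff_separable fin sub M(2))
  show "1 \<notin> T"
  proof
    assume "1 \<in> T"
    then have "1 \<in> f ` ?E"
      using T f by (auto simp: bij_betw_def)
    then obtain e where e: "e \<in> ?E" "f e = 1"
      by auto
    \<comment> \<open>The preimage \<open>e\<close> of 1 is no coloop, so some basis avoids it; but
      the image of that basis without its coloops must contain 1.\<close>
    then obtain B where B: "B \<in> bases M" "e \<notin> B"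
      unfolding coloops_def by auto
    have "1 \<in> f ` (B - ?C)"
      using one_in_basis_shifted[OF T \<open>1 \<in> T\<close>] B F by blast
    then obtain e' where "e' \<in> B - ?C" "f e' = f e"
      using e by auto
    moreover have "e' \<in> ?E"
      using \<open>e' \<in> B - ?C\<close> B sub by blast
    ultimately have "e' = e"
      using f e(1) unfolding bij_betw_def by (meson inj_onD)
    with B \<open>e' \<in> B - ?C\<close> show False
      by simp
  qed
qed

section \<open>Case distinction by the number of blocks\<close>

theorem theorem2:
  fixes M :: "'a matroid" and n :: nat and T :: "nat set"
  assumes "is_matroid M"
    and "shifted M"
    and "rank M > 0"
    and "T \<subseteq> {1..n}"
    and "isomorphic (contract M (coloops M)) (shifted_matroid n T)"
  shows "(length (blocks T) \<ge> 4 \<longrightarrow> \<not> threshold M) \<and>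
    (length (blocks T) \<le> 2 \<longrightarrow> threshold M) \<and>
    (length (blocks T) = 3 \<longrightarrow>
       (card (blocks T ! 1) = 1 \<or> card (gaps n T ! 1) = 1 \<longrightarrow> threshold M) \<and>
       (\<not> (card (blocks T ! 1) = 1 \<or> card (gaps n T ! 1) = 1) \<longrightarrow> \<not> threshold M))"
proof -
  note T = assms(4)
  note thr = threshold_iff_separable_shifted(1)[OF assms(1,3,4,5)]
    and one = threshold_iff_separable_shifted(2)[OF assms(1,3,4,5)]
  obtain ps where ps: "separated ps" "T = intervals_union ps"
    using ex_separated[of T] T finite_subset by blast
  have blocks: "blocks T = map (\<lambda>p. {fst p..snd p}) ps"
    unfolding ps(2) by (rule blocks_intervals_union[OF ps(1)])
  consider "ps = []" | p where "ps = [p]" | p q where "ps = [p, q]"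
    | p q r where "ps = [p, q, r]" | p q r s qs where "ps = p # q # r # s # qs"
    by (metis list.exhaust)
  then show ?thesis
  proof cases
    case 1
    then show ?thesis
      using separable_shifted_empty ps thr blocks by simp
  next
    case 2
    then show ?thesis
      using separable_shifted_one_block[of "fst p" "snd p" n] ps T thr blocks by simp
  next
    case 3
    then show ?thesis
      using separable_shifted_two_blocks[of "fst p" "snd p" "fst q" "snd q" n] ps T thr blocks
      by simp
  next
    case 4
    note sep = ps(1)[unfolded 4] and Teq = ps(2)[unfolded 4]
    have ord: "fst p \<le> snd p" "Suc (snd p) < fst q" "fst q \<le> snd q" "Suc (snd q) < fst r"
      "fst r \<le> snd r"
      using sep by auto
    have "card (blocks T ! 1) = 1 \<longleftrightarrow> fst q = snd q"
      using blocks 4 ord by auto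
    moreover have "card (gaps n T ! 1) = 1 \<longleftrightarrow> fst q = Suc (Suc (snd p))"
      unfolding second_gap_three_blocks[OF sep Teq T one] using ord by auto
    moreover have "threshold M" if "fst q = snd q \<or> fst q = Suc (Suc (snd p))"
      using separable_shifted_three_blocks[of "fst p" "snd p" "fst q" "snd q" "fst r" "snd r" n]
        Teq T ord that thr by (simp add: Un_assoc)
    moreover have "\<not> threshold M" if "\<not> (fst q = snd q \<or> fst q = Suc (Suc (snd p)))"
      using not_separable_three_blocks[OF sep Teq T one] that thr by blast
    ultimately show ?thesis
      using blocks 4 by simp
  next
    case 5
    then show ?thesis
      using not_separable_four_blocks[OF _ _ T one] ps thr blocks by auto
  qed
qed

end
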